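(* Let $f_i$, $h_i^{(r)}$ ($r=1,\dots,5$), $g_i^{(m)}$ ($m=1,\dots,7$) and $\Phi_i$ be the cost function, the equality and inequality constraint functions and the admissible coefficient set defined in the context. Then there is no duality gap in the problem $$\min_{\phi_i}\ f_i(\phi_i)\quad\text{subject to}\quad \phi_i\in\Phi_i,\quad h_i^{(r)}(\phi_i)=0\ (r=1,\dots,5),\quad g_i^{(m)}(\phi_i)\le 0\ (m=1,\dots,7).$$
   Context: Fix a connected and automated vehicle (CAV) $i$ crossing a control zone during $[t_i^0,t_i^f]$, entering at position $p_i(t_i^0)=0$ with speed $v_i^0$ and exiting at position $p_i^f$. Data: speed limits $0<v_{\min}\le v_{\max}$, control limits $u_{i,\min},u_{i,\max}$, time $t_i^m$ and position $p_i^m$ at which $i$ enters the merging zone, allowable entry speed $v_{\mathrm{entry}}$, standstill distance $\bar\delta$, headway $\rho_i$, a very small $\varepsilon>0$; the reaction constant of the CAV is $\xi_i=1$. Decision variable: $\phi_i=(\phi_{i,3},\phi_{i,2},\phi_{i,1},\phi_{i,0})\in\mathbb{R}^4$, $\phi_{i,3}\ne0$. It defines the position $p_i^*(t)=\phi_{i,3}t^3+\phi_{i,2}t^2+\phi_{i,1}t+\phi_{i,0}$ on $[t_i^0,t_i^f]$, which is strictly increasing because the speed satisfies $v_{\min}\le \dot p_i^*\le v_{\max}$. Its inverse is the time trajectory $$t_{p_i}(p)=\sqrt[3]{-\tfrac12 q+\sqrt{\tfrac14q^2+\tfrac1{27}\omega_{i,0}^3}}+\sqrt[3]{-\tfrac12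 q-\sqrt{\tfrac14q^2+\tfrac1{27}\omega_{i,0}^3}}+\omega_{i,3},\qquad q=\omega_{i,1}+\omega_{i,2}p,$$ with $\omega_{i,0}=\frac{\phi_{i,1}}{\phi_{i,3}}-\frac13\big(\frac{\phi_{i,2}}{\phi_{i,3}}\big)^2$, $\omega_{i,1}=\frac1{27}\Big[2\big(\frac{\phi_{i,2}}{\phi_{i,3}}\big)^3-\frac{9\phi_{i,2}\phi_{i,1}}{\phi_{i,3}^2}\Big]+\frac{\phi_{i,0}}{\phi_{i,3}}$, $\omega_{i,2}=-\frac1{\phi_{i,3}}$, $\omega_{i,3}=-\frac{\phi_{i,2}}{3\phi_{i,3}}$, and $\frac14q^2+\frac1{27}\omega_{i,0}^3>0$. Cost: $f_i(\phi_i)=t_{p_i}(p_i^f)$, $f_i:\Phi_i\to[t_i^0,t_i^f]$. Admissible set: $\Phi_i=\{\phi_i \mid f_i(\phi_i)\notin\bigcup_{\theta\in C_{o_i}}O_\theta\}$, where $C_{o_i}$ is the set of lanes that can be used by $i$ for its given entry and exit, and $O_\theta$ is the occupancy set of lane $\theta$, i.e. the collection of time intervals during which $\theta$ is occupied by a CAV. Equality constraints: $h_i^{(1)}=\phi_{i,3}(t_i^0)^3+\phi_{i,2}(t_i^0)^2+\phi_{i,1}t_i^0+\phi_{i,0}$; $h_i^{(2)}=\phi_{i,3}(t_i^f)^3+\phi_{i,2}(t_i^f)^2+\phi_{i,1}t_i^f+\phi_{i,0}-p_i^f$; $h_i^{(3)}=3\phi_{i,3}(t_i^0)^2+2\phi_{i,2}t_i^0+\phi_{i,1}-v_i^0$;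 $h_i^{(4)}=6\phi_{i,3}t_i^f+2\phi_{i,2}$; $h_i^{(5)}=\phi_{i,3}(t_i^m)^3+\phi_{i,2}(t_i^m)^2+\phi_{i,1}t_i^m+\phi_{i,0}-p_i^m$. Inequality constraints (with $\phi_k$ the given coefficients of the CAV $k$ preceding $i$, and $p_{k,i}$ the constant distance of a laterally conflicting CAV $k$ from the entry point of $i$): $g_i^{(1)}=3\phi_{i,3}\tau_v^2+2\phi_{i,2}\tau_v+\phi_{i,1}-v_{\max}+\varepsilon$; $g_i^{(2)}=v_{\min}-3\phi_{i,3}\tau_v^2-2\phi_{i,2}\tau_v-\phi_{i,1}+\varepsilon$; $g_i^{(3)}=6\phi_{i,3}t_i^0+2\phi_{i,2}-u_{i,\max}+\varepsilon$; $g_i^{(4)}=u_{i,\min}-6\phi_{i,3}t_i^0-2\phi_{i,2}+\varepsilon$; $g_i^{(5)}=\tau_s^3(\phi_{i,3}-\phi_{k,3})+\tau_s^2(\phi_{i,2}-\phi_{k,2}+3\rho_i\phi_{i,3})+\tau_s(\phi_{i,1}-\phi_{k,1}+2\rho_i\phi_{i,2})+\rho_i\phi_{i,1}+\phi_{i,0}-\phi_{k,0}+\bar\delta+\varepsilon$; $g_i^{(6)}=-p_{k,i}+\phi_{i,3}\tau_l^3+\tau_l^2(\phi_{i,2}+3\rho_i\phi_{i,3})+\tau_l(\phi_{i,1}+2\rho_i\phi_{i,2})+\rho_i\phi_{i,1}+\phi_{i,0}+\bar\delta+\varepsilon$; $g_i^{(7)}=3\phi_{i,3}(t_i^m)^2+2\phi_{i,2}t_i^m+\phi_{i,1}-v_{\mathrm{entry}}$.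 Here $\tau_v,\tau_s\in[t_i^0,t_i^f]$ and $\tau_l\in[t_i^0,t_i^e]$ ($t_i^e$ = exit time from the merging zone) are the times at which, respectively, the speed, the rear-end expression and the lateral expression (as functions of $t$) attain their extremum. All times appearing in $h_i^{(r)},g_i^{(m)}$ are held fixed when $\phi_i$ varies. Lagrangian: $L_i(\phi_i,\gamma_i,\nu_i)=f_i(\phi_i)+\gamma_i^Th_i(\phi_i)+\nu_i^Tg_i(\phi_i)$ with $\gamma_i\in\mathbb{R}^5$, $\nu_i\in\mathbb{R}^7_{\ge0}$. "No duality gap" means that the supremum over $(\gamma_i,\nu_i)\in\mathbb{R}^5\times\mathbb{R}^7_{\ge0}$ of $\inf_{\phi_i\in\Phi_i}L_i(\phi_i,\gamma_i,\nu_i)$ equals the optimal value of the problem.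
   Formalization: The problem is assumed to have at least one feasible point; without this the claim can fail, since the optimal value is then infinite while the dual value can stay finite (for example when the exit time lies in an occupied interval). *)

theory Defs
  imports "HOL-Analysis.Analysis"
begin

section \<open>Constrained minimisation and Lagrangian duality\<close>

text \<open>
  The problem is to minimise \<open>f x\<close> over \<open>x \<in> X\<close> subject to \<open>h x = 0\<close> and \<open>g x \<le> 0\<close>
  (componentwise).  Optimal values live in \<^typ>\<open>ereal\<close>, so that infima and suprema always exist.
\<close>

definition feasible_set :: "'a set \<Rightarrow> ('a \<Rightarrow> real ^ 'r) \<Rightarrow> ('a \<Rightarrow> real ^ 'm) \<Rightarrow> 'a set" where
  "feasible_set X h g = {x \<in> X. (\<forall>r. h x $ r = 0) \<and> (\<forall>m. g x $ m \<le> 0)}"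

definition optimal_value ::
    "'a set \<Rightarrow> ('a \<Rightarrow> real) \<Rightarrow> ('a \<Rightarrow> real ^ 'r) \<Rightarrow> ('a \<Rightarrow> real ^ 'm) \<Rightarrow> ereal" where
  "optimal_value X f h g = (INF x\<in>feasible_set X h g. ereal (f x))"

definition lagrangian ::
    "('a \<Rightarrow> real) \<Rightarrow> ('a \<Rightarrow> real ^ 'r) \<Rightarrow> ('a \<Rightarrow> real ^ 'm) \<Rightarrow> 'a \<Rightarrow> real ^ 'r \<Rightarrow> real ^ 'm \<Rightarrow> real" where
  "lagrangian f h g x \<gamma> \<nu> = f x + \<gamma> \<bullet> h x + \<nu> \<bullet> g x"

definition dual_value ::
    "'a set \<Rightarrow> ('a \<Rightarrow> real) \<Rightarrow> ('a \<Rightarrow> real ^ 'r) \<Rightarrow> ('a \<Rightarrow> real ^ 'm) \<Rightarrow> ereal" where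
  "dual_value X f h g =
     (SUP (\<gamma>, \<nu>)\<in>UNIV \<times> {\<nu>. \<forall>m. 0 \<le> \<nu> $ m}. INF x\<in>X. ereal (lagrangian f h g x \<gamma> \<nu>))"

definition no_duality_gap ::
    "'a set \<Rightarrow> ('a \<Rightarrow> real) \<Rightarrow> ('a \<Rightarrow> real ^ 'r) \<Rightarrow> ('a \<Rightarrow> real ^ 'm) \<Rightarrow> bool" where
  "no_duality_gap X f h g \<longleftrightarrow> dual_value X f h g = optimal_value X f h g"


section \<open>Cubic trajectories and their inverses\<close>

text \<open>
  The coefficient \<open>\<phi>\<^sub>j\<close> of \<open>t\<^sup>j\<close> is \<open>\<phi> $ j\<close>.  The four indices of \<^typ>\<open>real ^ 4\<close> are the residues
  modulo 4, so \<open>0, 1, 2, 3\<close> are distinct indices and exhaust the index type.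
\<close>

definition position :: "real ^ 4 \<Rightarrow> real \<Rightarrow> real" where
  "position \<phi> t = \<phi> $ 3 * t ^ 3 + \<phi> $ 2 * t ^ 2 + \<phi> $ 1 * t + \<phi> $ 0"

definition speed :: "real ^ 4 \<Rightarrow> real \<Rightarrow> real" where
  "speed \<phi> t = 3 * \<phi> $ 3 * t ^ 2 + 2 * \<phi> $ 2 * t + \<phi> $ 1"

definition acceleration :: "real ^ 4 \<Rightarrow> real \<Rightarrow> real" where
  "acceleration \<phi> t = 6 * \<phi> $ 3 * t + 2 * \<phi> $ 2"

definition omega0 :: "real ^ 4 \<Rightarrow> real" where
  "omega0 \<phi> = \<phi> $ 1 / \<phi> $ 3 - 1 / 3 * (\<phi> $ 2 / \<phi> $ 3) ^ 2"

definition omega1 :: "real ^ 4 \<Rightarrow> real" where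
  "omega1 \<phi> = 1 / 27 * (2 * (\<phi> $ 2 / \<phi> $ 3) ^ 3 - 9 * \<phi> $ 2 * \<phi> $ 1 / (\<phi> $ 3) ^ 2) + \<phi> $ 0 / \<phi> $ 3"

definition omega2 :: "real ^ 4 \<Rightarrow> real" where
  "omega2 \<phi> = - 1 / \<phi> $ 3"

definition omega3 :: "real ^ 4 \<Rightarrow> real" where
  "omega3 \<phi> = - \<phi> $ 2 / (3 * \<phi> $ 3)"

definition cardano_q :: "real ^ 4 \<Rightarrow> real \<Rightarrow> real" where
  "cardano_q \<phi> p = omega1 \<phi> + omega2 \<phi> * p"

definition cardano_disc :: "real ^ 4 \<Rightarrow> real \<Rightarrow> real" where
  "cardano_disc \<phi> p = 1 / 4 * (cardano_q \<phi> p) ^ 2 + 1 / 27 * (omega0 \<phi>) ^ 3"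

text \<open>\<^term>\<open>root 3\<close> is the real cube root, also for negative arguments.\<close>

definition time_trajectory :: "real ^ 4 \<Rightarrow> real \<Rightarrow> real" where
  "time_trajectory \<phi> p =
     root 3 (- 1 / 2 * cardano_q \<phi> p + sqrt (cardano_disc \<phi> p))
   + root 3 (- 1 / 2 * cardano_q \<phi> p - sqrt (cardano_disc \<phi> p))
   + omega3 \<phi>"


section \<open>The vehicle and its optimisation problem\<close>

text \<open>
  \<open>phi_prec\<close> holds the coefficients of the vehicle preceding the given one, \<open>p_lat\<close> the distance of
  the laterally conflicting vehicle from the entry point, and \<open>lanes\<close> the set of usable lanes.
  The occupancy set of a lane is a collection of time intervals.
\<close>

record 'lane cav_data =
  t_init :: real
  t_final :: real
  t_merge :: real
  t_merge_exit :: real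
  p_final :: real
  p_merge :: real
  v_init :: real
  v_min :: real
  v_max :: real
  v_entry :: real
  u_min :: real
  u_max :: real
  standstill :: real
  headway :: real
  eps :: real
  tau_v :: real
  tau_s :: real
  tau_l :: real
  phi_prec :: "real ^ 4"
  p_lat :: real
  lanes :: "'lane set"
  occupancy :: "'lane \<Rightarrow> real set set"

definition valid_data :: "'lane cav_data \<Rightarrow> bool" where
  "valid_data V \<longleftrightarrow>
     t_init V < t_final V \<and> 0 < v_min V \<and> v_min V \<le> v_max V \<and> 0 < eps V \<and>
     (\<forall>\<theta>\<in>lanes V. \<forall>I\<in>occupancy V \<theta>. is_interval I)"

text \<open>
  The coefficients that define a trajectory on the crossing interval: the speed respects its limits
  (hence the position is strictly increasing) and the closed form of the inverse applies at every
  position of the trajectory, of which the exit position has to be one.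
\<close>

definition decision_domain :: "'lane cav_data \<Rightarrow> (real ^ 4) set" where
  "decision_domain V = {\<phi>. \<phi> $ 3 \<noteq> 0 \<and>
     (\<forall>t\<in>{t_init V..t_final V}. v_min V \<le> speed \<phi> t \<and> speed \<phi> t \<le> v_max V) \<and>
     (\<forall>p\<in>position \<phi> ` {t_init V..t_final V}. 0 < cardano_disc \<phi> p) \<and>
     p_final V \<in> position \<phi> ` {t_init V..t_final V}}"

definition cost :: "'lane cav_data \<Rightarrow> real ^ 4 \<Rightarrow> real" where
  "cost V \<phi> = time_trajectory \<phi> (p_final V)"

definition admissible_set :: "'lane cav_data \<Rightarrow> (real ^ 4) set" where
  "admissible_set V =
     {\<phi> \<in> decision_domain V. cost V \<phi> \<notin> (\<Union>\<theta>\<in>lanes V. \<Union>(occupancy V \<theta>))}"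

definition rear_end :: "'lane cav_data \<Rightarrow> real ^ 4 \<Rightarrow> real \<Rightarrow> real" where
  "rear_end V \<phi> t =
     t ^ 3 * (\<phi> $ 3 - phi_prec V $ 3)
   + t ^ 2 * (\<phi> $ 2 - phi_prec V $ 2 + 3 * headway V * \<phi> $ 3)
   + t * (\<phi> $ 1 - phi_prec V $ 1 + 2 * headway V * \<phi> $ 2)
   + headway V * \<phi> $ 1 + \<phi> $ 0 - phi_prec V $ 0 + standstill V + eps V"

definition lateral :: "'lane cav_data \<Rightarrow> real ^ 4 \<Rightarrow> real \<Rightarrow> real" where
  "lateral V \<phi> t =
     - p_lat V + \<phi> $ 3 * t ^ 3
   + t ^ 2 * (\<phi> $ 2 + 3 * headway V * \<phi> $ 3)
   + t * (\<phi> $ 1 + 2 * headway V * \<phi> $ 2)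
   + headway V * \<phi> $ 1 + \<phi> $ 0 + standstill V + eps V"

definition eq_constraints :: "'lane cav_data \<Rightarrow> real ^ 4 \<Rightarrow> real ^ 5" where
  "eq_constraints V \<phi> = vector
     [position \<phi> (t_init V),
      position \<phi> (t_final V) - p_final V,
      speed \<phi> (t_init V) - v_init V,
      acceleration \<phi> (t_final V),
      position \<phi> (t_merge V) - p_merge V]"

definition ineq_constraints :: "'lane cav_data \<Rightarrow> real ^ 4 \<Rightarrow> real ^ 7" where
  "ineq_constraints V \<phi> = vector
     [speed \<phi> (tau_v V) - v_max V + eps V,
      v_min V - speed \<phi> (tau_v V) + eps V,
      acceleration \<phi> (t_init V) - u_max V + eps V,
      u_min V - acceleration \<phi> (t_init V) + eps V,
      rear_end V \<phi> (tau_s V),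
      lateral V \<phi> (tau_l V),
      speed \<phi> (t_merge V) - v_entry V]"

definition attains_extremum_at :: "(real \<Rightarrow> real) \<Rightarrow> real set \<Rightarrow> real \<Rightarrow> bool" where
  "attains_extremum_at F S t \<longleftrightarrow>
     t \<in> S \<and> ((\<forall>s\<in>S. F s \<le> F t) \<or> (\<forall>s\<in>S. F t \<le> F s))"

text \<open>
  The times \<open>tau_v\<close>, \<open>tau_s\<close>, \<open>tau_l\<close> are determined by one reference trajectory \<open>\<phi>\<close>; they are
  constants of the problem and do not follow the decision variable.
\<close>

definition extremal_times :: "'lane cav_data \<Rightarrow> real ^ 4 \<Rightarrow> bool" where
  "extremal_times V \<phi> \<longleftrightarrow>
     attains_extremum_at (speed \<phi>) {t_init V..t_final V} (tau_v V) \<and>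
     attains_extremum_at (rear_end V \<phi>) {t_init V..t_final V} (tau_s V) \<and>
     attains_extremum_at (lateral V \<phi>) {t_init V..t_merge_exit V} (tau_l V)"


section \<open>The closed form is the inverse of the position\<close>

lemma depressed_cubic_root:
  fixes w q :: real
  assumes "0 < 1 / 4 * q ^ 2 + 1 / 27 * w ^ 3"
  defines "s \<equiv> sqrt (1 / 4 * q ^ 2 + 1 / 27 * w ^ 3)"
  defines "x \<equiv> root 3 (- 1 / 2 * q + s) + root 3 (- 1 / 2 * q - s)"
  shows "x ^ 3 + w * x + q = 0"
proof -
  define A B where "A = root 3 (- 1 / 2 * q + s)" and "B = root 3 (- 1 / 2 * q - s)"
  have A3: "A ^ 3 = - 1 / 2 * q + s" and B3: "B ^ 3 = - 1 / 2 * q - s"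
    by (simp_all add: A_def B_def odd_real_root_pow)
  have s2: "s ^ 2 = 1 / 4 * q ^ 2 + 1 / 27 * w ^ 3"
    using assms by simp
  have "(- 1 / 2 * q + s) * (- 1 / 2 * q - s) = 1 / 4 * q ^ 2 - s ^ 2"
    by (simp add: algebra_simps power2_eq_square)
  also have "\<dots> = (- w / 3) ^ 3"
    by (simp add: s2 power3_eq_cube)
  finally have "A * B = root 3 ((- w / 3) ^ 3)"
    by (simp only: A_def B_def real_root_mult[symmetric])
  then have AB: "A * B = - w / 3"
    by (simp only: odd_real_root_power_cancel[OF odd_numeral])
  have "(A + B) ^ 3 = A ^ 3 + B ^ 3 + 3 * (A * B) * (A + B)"
    by (simp add: algebra_simps power3_eq_cube)
  then show ?thesis
    unfolding x_def A_def[symmetric] B_def[symmetric] by (simp add: A3 B3 AB algebra_simps)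
qed

lemma depressed_cubic_root_unique:
  fixes w q x y :: real
  assumes disc: "0 < 1 / 4 * q ^ 2 + 1 / 27 * w ^ 3"
    and x: "x ^ 3 + w * x + q = 0" and y: "y ^ 3 + w * y + q = 0"
  shows "x = y"
proof (rule ccontr)
  assume "x \<noteq> y"
  have "(x - y) * (x ^ 2 + x * y + y ^ 2 + w) = 0"
    using x y by (simp add: algebra_simps power2_eq_square power3_eq_cube)
  with \<open>x \<noteq> y\<close> have w: "w = - (x ^ 2 + x * y + y ^ 2)"
    by simp
  have q: "q = x * y * (x + y)"
    using x unfolding w by (simp add: algebra_simps power2_eq_square power3_eq_cube)
  have "27 * q ^ 2 + 4 * w ^ 3 = - (((x - y) * (2 * x + y) * (x + 2 * y)) ^ 2)"
    unfolding w q by (simp add: algebra_simps power2_eq_square power3_eq_cube)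
  then have "27 * q ^ 2 + 4 * w ^ 3 \<le> 0"
    by simp
  with disc show False
    by simp
qed

lemma position_eq_iff:
  assumes "\<phi> $ 3 \<noteq> 0"
  shows "position \<phi> t = p \<longleftrightarrow>
    (t - omega3 \<phi>) ^ 3 + omega0 \<phi> * (t - omega3 \<phi>) + cardano_q \<phi> p = 0"
proof -
  have "\<phi> $ 3 * ((t - omega3 \<phi>) ^ 3 + omega0 \<phi> * (t - omega3 \<phi>) + cardano_q \<phi> p) = position \<phi> t - p"
    using assms
    by (simp add: position_def omega0_def omega1_def omega2_def omega3_def cardano_q_def
        field_simps power2_eq_square power3_eq_cube)
  with assms show ?thesis
    by (metis eq_iff_diff_eq_0 mult_eq_0_iff)
qed

lemma position_time_trajectory:
  assumes "\<phi> $ 3 \<noteq> 0" "0 < cardano_disc \<phi> p"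
  shows "position \<phi> (time_trajectory \<phi> p) = p"
  using depressed_cubic_root[of "cardano_q \<phi> p" "omega0 \<phi>"] assms
  by (simp add: position_eq_iff time_trajectory_def cardano_disc_def)

lemma time_trajectory_position:
  assumes "\<phi> \<in> decision_domain V" "t \<in> {t_init V..t_final V}"
  shows "time_trajectory \<phi> (position \<phi> t) = t"
proof -
  have *: "\<phi> $ 3 \<noteq> 0" "0 < cardano_disc \<phi> (position \<phi> t)"
    using assms by (auto simp: decision_domain_def)
  have "position \<phi> (time_trajectory \<phi> (position \<phi> t)) = position \<phi> t"
    by (rule position_time_trajectory[OF *])
  then have "time_trajectory \<phi> (position \<phi> t) - omega3 \<phi> = t - omega3 \<phi>"
    using * depressed_cubic_root_unique[of "cardano_q \<phi> (position \<phi> t)" "omega0 \<phi>"]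
    unfolding cardano_disc_def by (metis position_eq_iff)
  then show ?thesis
    by simp
qed

lemma cost_in_crossing_interval:
  assumes "\<phi> \<in> decision_domain V"
  shows "cost V \<phi> \<in> {t_init V..t_final V}"
proof -
  obtain t where "t \<in> {t_init V..t_final V}" "p_final V = position \<phi> t"
    using assms by (auto simp: decision_domain_def)
  with time_trajectory_position[OF assms] show ?thesis
    by (simp add: cost_def)
qed

end

(* Every admissible trajectory passes the exit position at the time f = cost and moves at speed at
   least v_min until t_final, so position(t_final) - p_final \<ge> v_min * (t_final - f).
   Hence the multiplier 1 / v_min on the second equality constraint, and 0 elsewhere, keeps the
   Lagrangian above t_final on the whole admissible set, while no admissible cost exceeds t_final. *)
theory Submission
  imports Defs
begin

text \<open>At a feasible point the equality term of the Lagrangian vanishes and the inequality term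
  is nonpositive, so the infimum over \<open>X\<close> stays below every feasible cost.\<close>

lemma weak_duality:
  fixes h :: "'a \<Rightarrow> real ^ 'r" and g :: "'a \<Rightarrow> real ^ 'm"
  shows "dual_value X f h g \<le> optimal_value X f h g"
  unfolding dual_value_def optimal_value_def
proof (intro SUP_least INF_greatest, clarify)
  fix \<gamma> :: "real ^ 'r" and \<nu> :: "real ^ 'm" and x
  assume \<nu>: "\<forall>m. 0 \<le> \<nu> $ m" and x: "x \<in> feasible_set X h g"
  have "\<gamma> \<bullet> h x = 0"
    using x by (simp add: feasible_set_def inner_vec_def)
  moreover have "\<nu> \<bullet> g x \<le> 0"
    using x \<nu> by (auto simp: feasible_set_def inner_vec_def intro!: sum_nonpos mult_nonneg_nonpos)
  ultimately have "lagrangian f h g x \<gamma> \<nu> \<le> f x"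
    by (simp add: lagrangian_def)
  with x show "(INF x\<in>X. ereal (lagrangian f h g x \<gamma> \<nu>)) \<le> ereal (f x)"
    by (intro INF_lower2[of x]) (auto simp: feasible_set_def)
qed

text \<open>A certificate by squeezing: the chain optimal value \<le> \<open>c\<close> \<le> dual
  value closes up by weak duality, so one feasible point and one pair of multipliers
  suffice.\<close>

lemma no_duality_gapI:
  assumes "x \<in> feasible_set X h g" "f x \<le> c"
    and "\<And>m. 0 \<le> \<nu> $ m" "\<And>y. y \<in> X \<Longrightarrow> c \<le> lagrangian f h g y \<gamma> \<nu>"
  shows "no_duality_gap X f h g"
proof -
  have "optimal_value X f h g \<le> ereal c"
    unfolding optimal_value_def using assms(1,2) by (intro INF_lower2[of x]) auto
  also have "ereal c \<le> (INF y\<in>X. ereal (lagrangian f h g y \<gamma> \<nu>))"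
    using assms(4) by (intro INF_greatest) simp
  also have "\<dots> \<le> dual_value X f h g"
    unfolding dual_value_def using assms(3) by (intro SUP_upper2[of "(\<gamma>, \<nu>)"]) auto
  finally show ?thesis
    unfolding no_duality_gap_def by (intro antisym weak_duality)
qed

lemma DERIV_position: "(position \<phi> has_real_derivative speed \<phi> t) (at t)"
  unfolding position_def[abs_def] speed_def
  by (auto intro!: derivative_eq_intros simp: power2_eq_square)

text \<open>The function \<open>position \<phi> t - v * t\<close> has derivative
  \<open>speed \<phi> t - v\<close>, which is nonnegative on the interval, so it is nondecreasing
  there.\<close>

lemma position_diff_ge:
  assumes "a \<le> b" "\<And>t. a \<le> t \<Longrightarrow> t \<le> b \<Longrightarrow> v \<le> speed \<phi> t"
  shows "v * (b - a) \<le> position \<phi> b - position \<phi> a"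
proof -
  have "\<exists>y. ((\<lambda>t. position \<phi> t - v * t) has_real_derivative y) (at t) \<and> 0 \<le> y"
    if "a \<le> t" "t \<le> b" for t
    using DERIV_diff[OF DERIV_position DERIV_cmult_Id] assms(2)[OF that]
    by (intro exI[of _ "speed \<phi> t - v"]) simp
  from DERIV_nonneg_imp_nondecreasing[OF assms(1) this]
  have "position \<phi> a - v * a \<le> position \<phi> b - v * b" .
  then show ?thesis
    by (simp add: algebra_simps)
qed

text \<open>Membership in the domain puts \<open>p_final V\<close> among the positions of the
  trajectory, where the discriminant is positive and Cardano's formula gives a true
  preimage.\<close>

lemma position_cost:
  assumes "\<phi> \<in> decision_domain V"
  shows "position \<phi> (cost V \<phi>) = p_final V"
  using assms unfolding decision_domain_def cost_def by (blast intro: position_time_trajectory)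

lemma eq_constraints_nth_2: "eq_constraints V \<phi> $ 2 = position \<phi> (t_final V) - p_final V"
  unfolding eq_constraints_def vector_def by simp

theorem theorem6:
  fixes V :: "'lane cav_data" and \<phi>_ref :: "real ^ 4"
  assumes "valid_data V"
    and "extremal_times V \<phi>_ref"
    and "feasible_set (admissible_set V) (eq_constraints V) (ineq_constraints V) \<noteq> {}"
  shows "no_duality_gap (admissible_set V) (cost V) (eq_constraints V) (ineq_constraints V)"
proof -
  obtain \<psi> where \<psi>: "\<psi> \<in> feasible_set (admissible_set V) (eq_constraints V) (ineq_constraints V)"
    using assms(3) by blast
  then have "\<psi> \<in> decision_domain V"
    by (simp add: feasible_set_def admissible_set_def)
  then have "cost V \<psi> \<le> t_final V"
    using cost_in_crossing_interval by fastforce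
  moreover have "t_final V \<le> lagrangian (cost V) (eq_constraints V) (ineq_constraints V) \<phi>
      (axis 2 (1 / v_min V)) 0" if "\<phi> \<in> admissible_set V" for \<phi>
  proof -
    have dom: "\<phi> \<in> decision_domain V"
      using that by (simp add: admissible_set_def)
    \<comment> \<open>The speed bound holds on all of \<open>[cost V \<phi>, t_final V]\<close>,
      because the cost lies in the crossing interval.\<close>
    have "v_min V * (t_final V - cost V \<phi>) \<le> eq_constraints V \<phi> $ 2"
      using position_diff_ge[of "cost V \<phi>" "t_final V" "v_min V" \<phi>] dom
        cost_in_crossing_interval[OF dom]
      by (simp add: position_cost eq_constraints_nth_2 decision_domain_def)
    \<comment> \<open>The Lagrangian collapses to the cost plus \<open>1 / v_min V\<close> times the
      second constraint; dividing the bound by \<open>v_min V > 0\<close> cancels the cost and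
      leaves \<open>t_final V\<close>.\<close>
    with assms(1) show ?thesis
      by (simp add: lagrangian_def inner_axis' valid_data_def field_simps)
  qed
  ultimately show ?thesis
    using \<psi> by (intro no_duality_gapI[of \<psi> _ _ _ _ "t_final V" 0 "axis 2 (1 / v_min V)"]) auto
qed

end
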